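(* Let $G$ be an almost controllable graph on $n$ vertices, i.e. $G\in\mathcal{H}_n$, and let $H$ be a graph generalized cospectral with $G$. Then the equation $Q^{\mathrm T}A(G)Q=A(H)$ in the variable $Q\in \mathrm{RO}_n$ has exactly two solutions, namely $Q_0=W_0(G)W_0^{-1}(H)$ and $Q_1=W_1(G)W_0^{-1}(H)$, and both of them are rational matrices.
   Context: All graphs are simple with vertex set $\{1,\dots,n\}$; $A(G)$ is the adjacency matrix of $G$, $e$ is the all-ones vector, and the walk matrix is $W(G)=[e,A(G)e,\ldots,A^{n-1}(G)e]$. Two graphs $G,H$ on $\{1,\dots,n\}$ are generalized cospectral if $A(G),A(H)$ have the same spectrum and the adjacency matrices of the complements $\overline G,\overline H$ have the same spectrum. $\mathrm{RO}_n$ is the group of real orthogonal $n\times n$ matrices $Q$ with $Qe=e$. $\mathcal{H}_n$ is the set of graphs $G$ on $n$ vertices with $\mathrm{rank}\,W(G)=n-1$ (almost controllable graphs). For $G\in\mathcal{H}_n$, let $\xi(G)=(W_{1,n}(G),\ldots,W_{n,n}(G))^{\mathrm T}$, where $W_{i,n}(G)$ is the algebraic cofactor of the $(i,n)$-entry of $W(G)$, and for $\delta\in\{0,1\}$ let $W_\delta(G)=[e,A(G)e,\ldots,A^{n-2}(G)e,(-1)^\delta 2^{1-\lfloor n/2\rfloor}\xi(G)]$. (A graph generalized cospectral with a graph in $\mathcal{H}_n$ is itself in $\mathcal{H}_n$, and $W_\delta(G)$ is invertible for every $G\in\mathcal{H}_n$.) *)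

theory Defs
  imports
    Graph_Theory.Pair_Digraph
    Jordan_Normal_Form.DL_Rank
    Jordan_Normal_Form.Char_Poly
    Jordan_Normal_Form.Determinant
    Jordan_Normal_Form.Gauss_Jordan_Elimination
    "HOL-Computational_Algebra.Polynomial"
    Complex_Main
begin

text \<open>A \<^locale>\<open>pair_graph\<close> is finite, loopless and symmetric, and has no parallel arcs:
  a simple graph, each edge being represented by its two orientations.\<close>

definition graphs_on :: "nat \<Rightarrow> nat pair_pre_digraph set" where
  "graphs_on n = {G. pair_graph G \<and> pverts G = {1..n}}"

definition complement :: "'a pair_pre_digraph \<Rightarrow> 'a pair_pre_digraph" where
  "complement G = \<lparr> pverts = pverts G,
     parcs = {(u, v). u \<in> pverts G \<and> v \<in> pverts G \<and> u \<noteq> v \<and> (u, v) \<notin> parcs G} \<rparr>"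

text \<open>Matrix indices start at 0 whereas vertices start at 1.\<close>

definition adjacency_mat :: "nat \<Rightarrow> nat pair_pre_digraph \<Rightarrow> real mat" where
  "adjacency_mat n G = mat n n (\<lambda>(i, j). if (Suc i, Suc j) \<in> parcs G then 1 else 0)"

text \<open>The eigenvalues in the complex numbers, counted with algebraic multiplicity.\<close>

definition mat_spectrum :: "real mat \<Rightarrow> complex multiset" where
  "mat_spectrum A = proots (char_poly (map_mat complex_of_real A))"

definition generalized_cospectral ::
    "nat \<Rightarrow> nat pair_pre_digraph \<Rightarrow> nat pair_pre_digraph \<Rightarrow> bool" where
  "generalized_cospectral n G H \<longleftrightarrow>
     mat_spectrum (adjacency_mat n G) = mat_spectrum (adjacency_mat n H) \<and>
     mat_spectrum (adjacency_mat n (complement G)) = mat_spectrum (adjacency_mat n (complement H))"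

definition ones_vec :: "nat \<Rightarrow> real vec" where
  "ones_vec n = vec n (\<lambda>_. 1)"

text \<open>\<^const>\<open>orthogonal_mat\<close> only requires the columns to be nonzero and pairwise orthogonal,
  not normalized, hence the explicit equations.\<close>

definition RO :: "nat \<Rightarrow> real mat set" where
  "RO n = {Q \<in> carrier_mat n n.
     transpose_mat Q * Q = 1\<^sub>m n \<and> Q * transpose_mat Q = 1\<^sub>m n \<and> Q *\<^sub>v ones_vec n = ones_vec n}"

definition walk_mat :: "nat \<Rightarrow> nat pair_pre_digraph \<Rightarrow> real mat" where
  "walk_mat n G = mat_of_cols n (map (\<lambda>k. (adjacency_mat n G ^\<^sub>m k) *\<^sub>v ones_vec n) [0..<n])"

text \<open>The rank condition is stated additively because of the truncated subtraction
  on \<^typ>\<open>nat\<close>; in particular it forces \<^prop>\<open>n > 0\<close>.\<close>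

definition almost_controllable_graphs :: "nat \<Rightarrow> nat pair_pre_digraph set" where
  "almost_controllable_graphs n = {G \<in> graphs_on n. vec_space.rank n (walk_mat n G) + 1 = n}"

text \<open>In 0-based indexing the last column is \<open>n - 1\<close>; shifting both indices by one
  leaves the sign of the cofactor unchanged.\<close>

definition walk_cofactor_vec :: "nat \<Rightarrow> nat pair_pre_digraph \<Rightarrow> real vec" where
  "walk_cofactor_vec n G = vec n (\<lambda>i. cofactor (walk_mat n G) i (n - 1))"

definition modified_walk_mat :: "nat \<Rightarrow> nat \<Rightarrow> nat pair_pre_digraph \<Rightarrow> real mat" where
  "modified_walk_mat n \<delta> G = mat_of_cols n
     (map (\<lambda>k. (adjacency_mat n G ^\<^sub>m k) *\<^sub>v ones_vec n) [0..<n - 1] @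
      [((-1) ^ \<delta> * 2 powi (1 - int (n div 2))) \<cdot>\<^sub>v walk_cofactor_vec n G])"

end

theory Submission
  imports Defs
begin

text \<open>
  Let \<open>A\<close>, \<open>B\<close> be the adjacency matrices of \<open>G\<close>, \<open>H\<close>, let \<open>e\<close> be the all-ones vector and \<open>J = e e\<^sup>T\<close>.

  The two spectra know all walk counts \<open>e\<^sup>T A\<^sup>k e\<close>. The complement has adjacency matrix
  \<open>J - I - A\<close>, so its spectrum amounts to the characteristic polynomial of \<open>A - J\<close>, which differs from
  that of \<open>A\<close> by \<open>e\<^sup>T adj(xI - A) e\<close>. The polynomials \<open>e\<^sup>T adj(xI - A) A\<^sup>k e\<close> satisfy a recursion in \<open>k\<close>
  whose only other ingredients are the characteristic polynomial of \<open>A\<close> and the walk counts, and a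
  degree comparison reads each walk count off its leading coefficient
  (\<open>walk_counts_determined\<close>). As \<open>A\<close> is symmetric, the walk counts are the inner products of the
  vectors \<open>A\<^sup>i e\<close>, so these vectors have the same Gram matrix for \<open>G\<close> and for \<open>H\<close>.

  The cofactor vector \<open>\<xi>\<close> spans the orthogonal complement of \<open>e, \<dots>, A\<^sup>n\<^sup>-\<^sup>2 e\<close>: the determinant of
  \<open>[e, \<dots>, A\<^sup>n\<^sup>-\<^sup>2 e, v]\<close> is \<open>\<xi> \<bullet> v\<close>, and \<open>\<xi>\<close> is nonzero because the rank is \<open>n - 1\<close>
  (\<open>cofactor_vec_nonzero\<close>). The square of that determinant is a Gram determinant, so \<open>\<xi>\<close> has
  the same length for both graphs (\<open>cofactor_vec_norm_eq\<close>).

  Hence \<open>M = [e, \<dots>, A\<^sup>n\<^sup>-\<^sup>2 e, \<plusminus>c \<xi>(G)]\<close> and \<open>N = [e, \<dots>, B\<^sup>n\<^sup>-\<^sup>2 e, c \<xi>(H)]\<close> have the same Gram matrix,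
  which makes \<open>Q = M N\<^sup>-\<^sup>1\<close> orthogonal, and \<open>Q e = e\<close> by the first columns. The matrices \<open>M\<^sup>T A M\<close> and
  \<open>N\<^sup>T B N\<close> consist of walk counts and zeros and can differ only in the last diagonal entry. So
  \<open>Q\<^sup>T A Q - B\<close> is a multiple \<open>t p p\<^sup>T\<close> of a rank-one matrix with \<open>p \<noteq> 0\<close>; its trace is
  \<open>0\<close>, since \<open>A\<close> and \<open>B\<close> have zero diagonal and conjugation by \<open>Q\<close> preserves the trace. Hence
  \<open>t = 0\<close> (\<open>solution_conjugates\<close>). Conversely a solution \<open>Q\<close> maps \<open>B\<^sup>k e\<close> to \<open>A\<^sup>k e\<close>, hence
  \<open>\<xi>(H)\<close> into the line of \<open>\<xi>(G)\<close> and, by equality of lengths, to \<open>\<plusminus>\<xi>(G)\<close>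
  (\<open>solution_form\<close>). Rationality holds because the inverse of a rational matrix is given by cofactors.
\<close>

section \<open>Entries, lengths and traces\<close>

lemma mult_mat_vec_index_sum:
  assumes "A \<in> carrier_mat nr nc" "v \<in> carrier_vec nc" "i < nr"
  shows "(A *\<^sub>v v) $ i = (\<Sum>j<nc. A $$ (i, j) * v $ j)"
  using assms by (auto simp: scalar_prod_def atLeast0LessThan carrier_vecD intro!: sum.cong)

lemma scalar_prod_self_pos:
  fixes v :: "real vec"
  assumes v: "v \<in> carrier_vec n" "v \<noteq> 0\<^sub>v n"
  shows "v \<bullet> v > 0"
proof -
  obtain i where i: "i < n" "v $ i \<noteq> 0" using v by (metis carrier_vecD eq_vecI index_zero_vec)
  have "0 < (\<Sum>j<n. v $ j * v $ j)" by (rule sum_pos2[of _ i]) (use i in \<open>auto simp: zero_less_mult_iff\<close>)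
  thus ?thesis using v(1) by (simp add: scalar_prod_def atLeast0LessThan)
qed

lemma trace_mult_commute:
  fixes X Y :: "'a :: comm_ring_1 mat"
  assumes X: "X \<in> carrier_mat n n" and Y: "Y \<in> carrier_mat n n"
  shows "(\<Sum>i<n. (X * Y) $$ (i, i)) = (\<Sum>i<n. (Y * X) $$ (i, i))"
proof -
  have "(X * Y) $$ (i, i) = (\<Sum>j<n. X $$ (i, j) * Y $$ (j, i))" if "i < n" for i
    using that X Y by (simp add: scalar_prod_def atLeast0LessThan)
  moreover have "(Y * X) $$ (i, i) = (\<Sum>j<n. X $$ (j, i) * Y $$ (i, j))" if "i < n" for i
    using that X Y by (simp add: scalar_prod_def atLeast0LessThan mult.commute)
  ultimately have "(\<Sum>i<n. (X * Y) $$ (i, i)) = (\<Sum>i<n. \<Sum>j<n. X $$ (i, j) * Y $$ (j, i))"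
    "(\<Sum>i<n. (Y * X) $$ (i, i)) = (\<Sum>i<n. \<Sum>j<n. X $$ (j, i) * Y $$ (i, j))" by simp_all
  thus ?thesis using sum.swap[of "\<lambda>i j. X $$ (i, j) * Y $$ (j, i)" "{..<n}" "{..<n}"] by simp
qed

section \<open>Rank-one perturbations and characteristic polynomials\<close>

text \<open>The matrix determinant lemma with the adjugate in place of the inverse, so that it applies over
  the polynomial ring, where \<open>xI - A\<close> is regular but not invertible. Both sides are evaluated through
  the bordered matrix with blocks \<open>A\<close>, \<open>-u\<close>, \<open>v\<close>, \<open>1\<close>: one column operation clears \<open>v\<close>, another one clears
  \<open>-u\<close> at the cost of a factor \<open>det A\<close>.\<close>

lemma det_add_outer_product:
  fixes A :: "'a :: idom mat"
  assumes A: "A \<in> carrier_mat n n" and u: "u \<in> carrier_mat n 1" and v: "v \<in> carrier_mat 1 n"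
    and nz: "det A \<noteq> 0"
  shows "det (A + u * v) = det A + (v * (adj_mat A * u)) $$ (0, 0)"
proof -
  let ?d = "det A \<cdot>\<^sub>m 1\<^sub>m 1" and ?w = "adj_mat A * u"
  let ?B = "four_block_mat A (- u) v (1\<^sub>m 1)"
  note adj = adj_mat[OF A]
  have w: "?w \<in> carrier_mat n 1" using adj(1) u by simp
  have uv: "u * v \<in> carrier_mat n n" and vw: "v * ?w \<in> carrier_mat 1 1" using u v w by auto
  have B: "?B \<in> carrier_mat (n + 1) (n + 1)" using A by (auto intro: four_block_carrier_mat)
  have c1: "four_block_mat (1\<^sub>m n) (0\<^sub>m n 1) (- v) (1\<^sub>m 1) \<in> carrier_mat (n + 1) (n + 1)"
    by (auto intro: four_block_carrier_mat)
  have c2: "four_block_mat (1\<^sub>m n) ?w (0\<^sub>m 1 n) ?d \<in> carrier_mat (n + 1) (n + 1)"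
    by (auto intro: four_block_carrier_mat)
  \<comment> \<open>Clearing \<open>v\<close> turns the upper left block into \<open>A + u v\<close>.\<close>
  have "?B * four_block_mat (1\<^sub>m n) (0\<^sub>m n 1) (- v) (1\<^sub>m 1)
      = four_block_mat (A + u * v) (- u) (0\<^sub>m 1 n) (1\<^sub>m 1)"
    by (subst mult_four_block_mat[of _ n n _ 1 _ 1 _ _ n _ 1]) (use A u v uv in auto)
  from arg_cong[OF this, of det] have detB: "det ?B = det (A + u * v)"
    unfolding det_mult[OF B c1]
    using A u v uv by (simp add: det_four_block_mat_upper_right_zero[of _ n _ 1]
      det_four_block_mat_lower_left_zero[of _ n _ 1])
  \<comment> \<open>Clearing \<open>-u\<close> instead leaves \<open>A\<close> in place and multiplies the determinant by \<open>det A\<close>.\<close>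
  have Aw: "A * ?w = det A \<cdot>\<^sub>m u"
    using A adj(1) u by (subst assoc_mult_mat[symmetric, of _ n n _ n _ 1])
      (auto simp: adj(2) mult_smult_assoc_mat[of _ n n _ 1])
  have "?B * four_block_mat (1\<^sub>m n) ?w (0\<^sub>m 1 n) ?d
      = four_block_mat (A * 1\<^sub>m n + - u * 0\<^sub>m 1 n) (A * ?w + - u * ?d)
          (v * 1\<^sub>m n + 1\<^sub>m 1 * 0\<^sub>m 1 n) (v * ?w + 1\<^sub>m 1 * ?d)"
    by (rule mult_four_block_mat[of _ n n _ 1 _ 1 _ _ n _ 1]) (use A u v w in auto)
  also have "\<dots> = four_block_mat A (0\<^sub>m n 1) v (v * ?w + ?d)"
  proof (rule cong_four_block_mat)
    show "A * ?w + - u * ?d = 0\<^sub>m n 1"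
      unfolding Aw using u by (intro eq_matI) (auto simp: scalar_prod_def)
  qed (use A u v w in auto)
  finally have eq: "?B * four_block_mat (1\<^sub>m n) ?w (0\<^sub>m 1 n) ?d
      = four_block_mat A (0\<^sub>m n 1) v (v * ?w + ?d)" .
  have "det ?B * det A = det A * det (v * ?w + ?d)"
    using arg_cong[OF eq, of det] unfolding det_mult[OF B c2] using A u v w vw
    by (simp add: det_four_block_mat_upper_right_zero[of _ n _ 1]
      det_four_block_mat_lower_left_zero[of _ n _ 1])
  hence "det (A + u * v) = det (v * ?w + ?d)" using nz detB by simp
  also have "\<dots> = (v * ?w) $$ (0, 0) + det A" using vw
    by (subst det_single) (auto)
  finally show ?thesis by simp
qed

lemma const_poly_sum: "[:\<Sum>i\<in>I. f i:] = (\<Sum>i\<in>I. [:f i :: 'a :: comm_monoid_add:])"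
proof (induction I rule: infinite_finite_induct)
  case (insert x F)
  have "[:\<Sum>i\<in>insert x F. f i:] = [:f x:] + [:sum f F:]" using insert(1,2) by simp
  also note insert(3)
  finally show ?case using insert(1,2) by simp
qed auto

text \<open>This is \<open>e\<^sup>T adj(xI - A) u\<close>, the numerator of the resolvent entry \<open>e\<^sup>T (xI - A)\<^sup>-\<^sup>1 u\<close> over
  the characteristic polynomial.\<close>

definition adj_sum :: "nat \<Rightarrow> real mat \<Rightarrow> real vec \<Rightarrow> real poly" where
  "adj_sum n A u = (\<Sum>i<n. (adj_mat (char_poly_matrix A) *\<^sub>v map_vec (\<lambda>a. [:a:]) u) $ i)"

text \<open>Apply \<open>adj(xI - A)\<close> to \<open>(xI - A) u = x u - A u\<close>, whose image is \<open>u\<close> times the characteristic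
  polynomial, and add up the entries.\<close>

lemma adj_sum_mult:
  assumes A: "A \<in> carrier_mat n n" and u: "u \<in> carrier_vec n"
  shows "adj_sum n A (A *\<^sub>v u) = [:0, 1:] * adj_sum n A u - Polynomial.smult (\<Sum>i<n. u $ i) (char_poly A)"
proof -
  let ?M = "char_poly_matrix A" and ?c = "map_vec (\<lambda>a. [:a:] :: real poly)"
  have M: "?M \<in> carrier_mat n n" using A by simp
  note adj = adj_mat[OF M]
  have cu: "?c u \<in> carrier_vec n" "?c (A *\<^sub>v u) \<in> carrier_vec n" using A u by auto
  have sm: "adj_mat ?M *\<^sub>v (k \<cdot>\<^sub>v v) = k \<cdot>\<^sub>v (adj_mat ?M *\<^sub>v v)" if "v \<in> carrier_vec n" for k v
    by (rule eq_vecI) (use that adj(1) in auto)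
  have "?M *\<^sub>v ?c u = [:0, 1:] \<cdot>\<^sub>v ?c u - ?c (A *\<^sub>v u)"
  proof (rule eq_vecI)
    fix i assume "i < dim_vec ([:0, 1:] \<cdot>\<^sub>v ?c u - ?c (A *\<^sub>v u))"
    hence i: "i < n" using A by simp
    have "(?M *\<^sub>v ?c u) $ i = (\<Sum>j<n. (if i = j then [:0, 1:] * [:u $ j:] else 0) - [:A $$ (i, j) * u $ j:])"
      using i A u unfolding char_poly_matrix_def
      by (auto simp: scalar_prod_def atLeast0LessThan algebra_simps intro!: sum.cong)
    also have "\<dots> = [:0, 1:] * [:u $ i:] - [:\<Sum>j<n. A $$ (i, j) * u $ j:]"
      using i by (simp add: sum_subtractf const_poly_sum)
    also have "\<dots> = ([:0, 1:] \<cdot>\<^sub>v ?c u - ?c (A *\<^sub>v u)) $ i"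
      using i A u by (simp add: scalar_prod_def atLeast0LessThan)
    finally show "(?M *\<^sub>v ?c u) $ i = ([:0, 1:] \<cdot>\<^sub>v ?c u - ?c (A *\<^sub>v u)) $ i" .
  qed (use A M in \<open>auto simp: carrier_matD[OF M]\<close>)
  hence "adj_mat ?M *\<^sub>v ([:0, 1:] \<cdot>\<^sub>v ?c u - ?c (A *\<^sub>v u)) = adj_mat ?M *\<^sub>v (?M *\<^sub>v ?c u)" by simp
  also have "\<dots> = (adj_mat ?M * ?M) *\<^sub>v ?c u" using adj(1) M cu by (simp add: assoc_mult_mat_vec)
  also have "\<dots> = char_poly A \<cdot>\<^sub>v ?c u" unfolding adj(3) char_poly_def using cu
    by (intro eq_vecI) (auto)
  finally have "[:0, 1:] \<cdot>\<^sub>v (adj_mat ?M *\<^sub>v ?c u) - adj_mat ?M *\<^sub>v ?c (A *\<^sub>v u) = char_poly A \<cdot>\<^sub>v ?c u"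
    using cu by (simp add: mult_minus_distrib_mat_vec[OF adj(1)] sm)
  hence e: "([:0, 1:] \<cdot>\<^sub>v (adj_mat ?M *\<^sub>v ?c u) - adj_mat ?M *\<^sub>v ?c (A *\<^sub>v u)) $ i = (char_poly A \<cdot>\<^sub>v ?c u) $ i" for i
    by simp
  have "[:0, 1:] * (adj_mat ?M *\<^sub>v ?c u) $ i - (adj_mat ?M *\<^sub>v ?c (A *\<^sub>v u)) $ i = 
     Polynomial.smult (u $ i) (char_poly A)" if "i < n" for i
    using e[of i] that adj(1) u A by simp
  hence eq: "(\<Sum>i<n. [:0, 1:] * (adj_mat ?M *\<^sub>v ?c u) $ i - (adj_mat ?M *\<^sub>v ?c (A *\<^sub>v u)) $ i)
     = (\<Sum>i<n. Polynomial.smult (u $ i) (char_poly A))" by simp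
  have "(\<Sum>i<n. Polynomial.smult (u $ i) (char_poly A)) = Polynomial.smult (\<Sum>i<n. u $ i) (char_poly A)"
    by (simp add: smult_sum)
  thus ?thesis using eq unfolding adj_sum_def sum_subtractf sum_distrib_left[symmetric]
    by (simp add: algebra_simps)
qed

text \<open>The entries of the adjugate are minors of size \<open>n - 1\<close> of a matrix whose entries have degree at
  most \<open>1\<close>.\<close>

lemma degree_adj_sum:
  assumes A: "A \<in> carrier_mat n n" and u: "u \<in> carrier_vec n" and n: "n > 0"
  shows "degree (adj_sum n A u) < n"
proof -
  let ?M = "char_poly_matrix A"
  have M: "?M \<in> carrier_mat n n" using A by simp
  hence dim: "dim_row ?M = n" "dim_col ?M = n" by auto
  have cof: "degree (cofactor ?M i j) \<le> n - 1" if "i < n" "j < n" for i j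
  proof -
    have "degree (det (mat_delete ?M i j)) \<le> 1 * (n - 1)"
    proof (rule degree_det_le)
      show "mat_delete ?M i j \<in> carrier_mat (n - 1) (n - 1)" using M by (rule mat_delete_carrier)
      show "degree (mat_delete ?M i j $$ (k, l)) \<le> 1" if "k < n - 1" "l < n - 1" for k l
        using that A by (auto simp: mat_delete_def char_poly_matrix_def)
    qed
    thus ?thesis unfolding cofactor_def
      by (cases "even (i + j)") auto
  qed
  have "degree (adj_sum n A u) \<le> n - 1" unfolding adj_sum_def
  proof (rule degree_sum_le)
    fix i assume "i \<in> {..<n}"
    thus "degree ((adj_mat ?M *\<^sub>v map_vec (\<lambda>a. [:a:]) u) $ i) \<le> n - 1"
      using dim u cof by (auto simp: adj_mat_def scalar_prod_def index_mult_mat_vec intro!: degree_sum_le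
        order.trans[OF degree_mult_le] simp del: char_poly_matrix_closed)
  qed simp
  thus ?thesis using n by simp
qed

text \<open>The matrix determinant lemma for \<open>xI - A + e e\<^sup>T\<close>.\<close>

lemma adj_sum_ones:
  assumes A: "A \<in> carrier_mat n n"
  shows "adj_sum n A (ones_vec n) = char_poly (A - mat n n (\<lambda>_. 1)) - char_poly A"
proof -
  let ?M = "char_poly_matrix A"
  let ?u = "mat n 1 (\<lambda>_. 1) :: real poly mat" and ?v = "mat 1 n (\<lambda>_. 1) :: real poly mat"
  have M: "?M \<in> carrier_mat n n" using A by simp
  note adj = adj_mat[OF M]
  have "char_poly (A - mat n n (\<lambda>_. 1)) = det (?M + ?u * ?v)" unfolding char_poly_def
    by (rule arg_cong[of _ _ det], rule eq_matI)
       (use A in \<open>auto simp: char_poly_matrix_def scalar_prod_def one_pCons\<close>)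
  also have "\<dots> = det ?M + (?v * (adj_mat ?M * ?u)) $$ (0, 0)"
    by (rule det_add_outer_product[OF M])
       (use degree_monic_char_poly[OF A] in \<open>auto simp: char_poly_def[symmetric]\<close>)
  also have "(?v * (adj_mat ?M * ?u)) $$ (0, 0) = adj_sum n A (ones_vec n)"
    using adj(1) unfolding adj_sum_def
    by (auto simp: scalar_prod_def ones_vec_def one_pCons atLeast0LessThan intro!: sum.cong)
  finally show ?thesis unfolding char_poly_def by simp
qed

section \<open>Walk counts determined by two spectra\<close>

definition walk_vec :: "nat \<Rightarrow> real mat \<Rightarrow> nat \<Rightarrow> real vec" where
  "walk_vec n A k = (A ^\<^sub>m k) *\<^sub>v ones_vec n"

lemma walk_vec_carrier [simp]: "A \<in> carrier_mat n n \<Longrightarrow> walk_vec n A k \<in> carrier_vec n"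
  unfolding walk_vec_def ones_vec_def
  by (rule mult_mat_vec_carrier[of _ n n]) (auto intro: pow_carrier_mat)

lemma dim_walk_vec [simp]: "A \<in> carrier_mat n n \<Longrightarrow> dim_vec (walk_vec n A k) = n"
  using walk_vec_carrier carrier_vecD by blast

lemma walk_vec_0: "A \<in> carrier_mat n n \<Longrightarrow> walk_vec n A 0 = ones_vec n"
  unfolding walk_vec_def ones_vec_def by auto

lemma pow_mat_Suc_left:
  assumes "A \<in> carrier_mat n n" shows "A ^\<^sub>m Suc k = A * A ^\<^sub>m k"
proof (induction k)
  case (Suc k)
  have "A ^\<^sub>m Suc (Suc k) = (A * A ^\<^sub>m k) * A" using Suc by simp
  also have "\<dots> = A * A ^\<^sub>m Suc k" using assms by (simp add: assoc_mult_mat[of _ n n _ n _ n])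
  finally show ?case .
qed (use assms in simp)

lemma walk_vec_Suc:
  assumes "A \<in> carrier_mat n n" shows "walk_vec n A (Suc k) = A *\<^sub>v walk_vec n A k"
  unfolding walk_vec_def pow_mat_Suc_left[OF assms]
  by (rule assoc_mult_mat_vec[of _ n n _ n]) (use assms in \<open>auto simp: ones_vec_def\<close>)

text \<open>In \<open>e\<^sup>T adj(xI - A) A\<^sup>k\<^sup>+\<^sup>1 e = x e\<^sup>T adj(xI - A) A\<^sup>k e - (e\<^sup>T A\<^sup>k e) p\<close>, with \<open>p\<close> the
  characteristic polynomial, the left side has degree below \<open>n = deg p\<close>. Comparing coefficients at \<open>n\<close>
  shows that the \<open>k\<close>-th polynomial determines the \<open>k\<close>-th walk count, and then also the next
  polynomial; the \<open>0\<close>-th is the difference of the two given characteristic polynomials.\<close>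

lemma walk_counts_determined:
  assumes A: "A \<in> carrier_mat n n" and B: "B \<in> carrier_mat n n" and n: "n > 0"
    and p: "char_poly A = char_poly B"
    and q: "char_poly (A - mat n n (\<lambda>_. 1)) = char_poly (B - mat n n (\<lambda>_. 1))"
  shows "(\<Sum>i<n. walk_vec n A k $ i) = (\<Sum>i<n. walk_vec n B k $ i)"
proof -
  let ?f = "\<lambda>A k. adj_sum n A (walk_vec n A k)"
  have coeff: "(\<Sum>i<n. walk_vec n A k $ i) = coeff (?f A k) (n - 1)"
    if A: "A \<in> carrier_mat n n" for A k
  proof -
    obtain m where m: "n = Suc m" using n by (cases n) auto
    have "degree (?f A (Suc k)) < n" using degree_adj_sum A n by simp
    hence "0 = coeff (?f A (Suc k)) n" by (simp add: coeff_eq_0)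
    also have "\<dots> = coeff (?f A k) m - (\<Sum>i<n. walk_vec n A k $ i)"
      unfolding walk_vec_Suc[OF A] using adj_sum_mult[OF A walk_vec_carrier[OF A]]
        degree_monic_char_poly[OF A] m by simp
    finally show ?thesis using m by simp
  qed
  have "?f A k = ?f B k"
  proof (induction k)
    case 0
    show ?case using A B p q by (simp add: walk_vec_0 adj_sum_ones)
  next
    case (Suc k)
    have "(\<Sum>i<n. walk_vec n A k $ i) = (\<Sum>i<n. walk_vec n B k $ i)"
      using coeff A B Suc by simp
    thus ?case using Suc p A B by (simp add: walk_vec_Suc adj_sum_mult)
  qed
  thus ?thesis using coeff A B by simp
qed

text \<open>The matrix \<open>J - I - A\<close> is the adjacency matrix of the complement, and
  \<open>zI - (A - J) = -((-z-1)I - (J - I - A))\<close>. So one characteristic polynomial is the other one at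
  \<open>-z-1\<close>, up to the sign \<open>(-1)\<^sup>n\<close>.\<close>

lemma char_poly_minus_ones_from_complement:
  assumes A: "A \<in> carrier_mat n n" and B: "B \<in> carrier_mat n n"
    and c: "char_poly (mat n n (\<lambda>_. 1) - 1\<^sub>m n - A) = char_poly (mat n n (\<lambda>_. 1) - 1\<^sub>m n - B)"
  shows "char_poly (A - mat n n (\<lambda>_. 1 :: real)) = char_poly (B - mat n n (\<lambda>_. 1))"
proof -
  let ?J = "mat n n (\<lambda>_. 1 :: real)"
  have "poly (char_poly (A - ?J)) z = (-1) ^ n * poly (char_poly (?J - 1\<^sub>m n - A)) (- z - 1)"
    if A: "A \<in> carrier_mat n n" for A z
  proof -
    have "- char_matrix (A - ?J) z = (-1) \<cdot>\<^sub>m (- char_matrix (?J - 1\<^sub>m n - A) (- z - 1))"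
      by (rule eq_matI) (use A in \<open>auto simp: char_matrix_def\<close>)
    thus ?thesis using A by (subst (1 2) char_poly_matrix[of _ n]) (auto simp: minus_carrier_mat char_matrix_def)
  qed
  hence "poly (char_poly (A - ?J)) z = poly (char_poly (B - ?J)) z" for z using A B c by simp
  thus ?thesis by (intro poly_eq_poly_eq_iff[THEN iffD1]) auto
qed

text \<open>A monic complex polynomial is the product of the linear factors of its roots.\<close>

lemma char_poly_eq_if_mat_spectrum_eq:
  assumes A: "A \<in> carrier_mat n n" and B: "B \<in> carrier_mat n n"
    and s: "mat_spectrum A = mat_spectrum B"
  shows "char_poly A = char_poly B"
proof -
  have cp: "char_poly (map_mat complex_of_real A) = (\<Prod>x\<in>#mat_spectrum A. [:- x, 1:])"
    if A: "A \<in> carrier_mat n n" for A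
    using complex_poly_decompose_multiset[of "char_poly (map_mat complex_of_real A)"]
      degree_monic_char_poly[of "map_mat complex_of_real A" n] A
    unfolding mat_spectrum_def by simp
  have "map_poly complex_of_real (char_poly A) = map_poly complex_of_real (char_poly B)"
    using cp[OF A] cp[OF B] s of_real_hom.char_poly_hom[OF A, where ?'a = complex]
      of_real_hom.char_poly_hom[OF B, where ?'a = complex]
    by simp
  thus ?thesis by (intro poly_eqI) (metis coeff_map_poly of_real_0 of_real_eq_iff)
qed

section \<open>Walk matrices with a prescribed last column\<close>

text \<open>The matrix \<open>[e, A e, \<dots>, A\<^sup>n\<^sup>-\<^sup>2 e, v]\<close> covers both the walk matrix, with \<open>v = A\<^sup>n\<^sup>-\<^sup>1 e\<close>, and its
  modifications, with \<open>v\<close> a multiple of the cofactor vector.\<close>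

definition bordered_walk_mat :: "nat \<Rightarrow> real mat \<Rightarrow> real vec \<Rightarrow> real mat" where
  "bordered_walk_mat n A v = mat_of_cols n (map (walk_vec n A) [0..<n - 1] @ [v])"

lemma bordered_walk_mat_carrier [simp]:
  "n > 0 \<Longrightarrow> bordered_walk_mat n A v \<in> carrier_mat n n"
  unfolding bordered_walk_mat_def
  using mat_of_cols_carrier(1)[of n "map (walk_vec n A) [0..<n - 1] @ [v]"] by simp

lemma col_bordered_walk_mat:
  assumes "n > 0" "A \<in> carrier_mat n n" "v \<in> carrier_vec n" "j < n"
  shows "col (bordered_walk_mat n A v) j = (if j = n - 1 then v else walk_vec n A j)"
  unfolding bordered_walk_mat_def using assms
  by (subst col_mat_of_cols) (auto simp: nth_append)

lemma index_bordered_walk_mat: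
  assumes "n > 0" "i < n" "j < n"
  shows "bordered_walk_mat n A v $$ (i, j) = (if j = n - 1 then v $ i else walk_vec n A j $ i)"
  unfolding bordered_walk_mat_def using assms
  by (subst mat_of_cols_index) (auto simp: nth_append)

text \<open>The vector \<open>\<xi>\<close>; the cofactors of the last column do not depend on that column.\<close>

definition cofactor_vec :: "nat \<Rightarrow> real mat \<Rightarrow> real vec" where
  "cofactor_vec n A = vec n (\<lambda>i. cofactor (bordered_walk_mat n A (walk_vec n A (n - 1))) i (n - 1))"

lemma cofactor_vec_carrier [simp]: "cofactor_vec n A \<in> carrier_vec n"
  unfolding cofactor_vec_def by simp

lemma dim_cofactor_vec [simp]: "dim_vec (cofactor_vec n A) = n"
  unfolding cofactor_vec_def by simp

text \<open>Laplace expansion along the last column.\<close>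

lemma det_bordered_walk_mat:
  assumes n: "n > 0" and v: "v \<in> carrier_vec n"
  shows "det (bordered_walk_mat n A v) = cofactor_vec n A \<bullet> v"
proof -
  have del: "mat_delete (bordered_walk_mat n A v) i (n - 1)
      = mat_delete (bordered_walk_mat n A (walk_vec n A (n - 1))) i (n - 1)" for i
    unfolding mat_delete_def using n carrier_matD[OF bordered_walk_mat_carrier[OF n, of A]]
    by (intro cong_mat) (simp_all add: index_bordered_walk_mat)
  hence "cofactor (bordered_walk_mat n A v) i (n - 1) = cofactor_vec n A $ i" if "i < n" for i
    using that unfolding cofactor_vec_def cofactor_def by (simp only: index_vec del)
  note cof = this
  have "det (bordered_walk_mat n A v) = (\<Sum>i<n. bordered_walk_mat n A v $$ (i, n - 1)
      * cofactor (bordered_walk_mat n A v) i (n - 1))"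
    by (rule laplace_expansion_column) (use n in auto)
  also have "\<dots> = (\<Sum>i<n. cofactor_vec n A $ i * v $ i)"
    by (rule sum.cong) (use n cof in \<open>simp_all add: index_bordered_walk_mat\<close>)
  also have "\<dots> = cofactor_vec n A \<bullet> v" using v by (simp add: scalar_prod_def atLeast0LessThan)
  finally show ?thesis .
qed

text \<open>With a repeated column the determinant vanishes.\<close>

lemma cofactor_vec_orthogonal:
  assumes A: "A \<in> carrier_mat n n" and k: "k < n - 1"
  shows "cofactor_vec n A \<bullet> walk_vec n A k = 0"
proof -
  have "det (bordered_walk_mat n A (walk_vec n A k)) = 0"
    by (rule det_identical_columns[of _ n k "n - 1"]) (use A k in \<open>auto simp: col_bordered_walk_mat\<close>)
  thus ?thesis using A k by (simp add: det_bordered_walk_mat)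
qed

definition orthogonal_to_walks :: "nat \<Rightarrow> real mat \<Rightarrow> real vec \<Rightarrow> bool" where
  "orthogonal_to_walks n A u \<longleftrightarrow> u \<in> carrier_vec n \<and> (\<forall>k<n - 1. walk_vec n A k \<bullet> u = 0)"

lemma orthogonal_to_walksD:
  assumes "orthogonal_to_walks n A u" and A: "A \<in> carrier_mat n n"
  shows "u \<in> carrier_vec n" "k < n - 1 \<Longrightarrow> walk_vec n A k \<bullet> u = 0" "k < n - 1 \<Longrightarrow> u \<bullet> walk_vec n A k = 0"
  using assms comm_scalar_prod[of "walk_vec n A k" n u] by (auto simp: orthogonal_to_walks_def)

lemma orthogonal_to_walks_smult:
  assumes "orthogonal_to_walks n A u" "A \<in> carrier_mat n n"
  shows "orthogonal_to_walks n A (c \<cdot>\<^sub>v u)"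
  using assms by (auto simp: orthogonal_to_walks_def)

lemma orthogonal_to_walks_cofactor_vec:
  assumes A: "A \<in> carrier_mat n n"
  shows "orthogonal_to_walks n A (cofactor_vec n A)"
  using cofactor_vec_orthogonal[OF A] comm_scalar_prod[OF cofactor_vec_carrier walk_vec_carrier[OF A]]
  by (auto simp: orthogonal_to_walks_def)

text \<open>A vector in the kernel of the singular matrix \<open>[e, \<dots>, A\<^sup>n\<^sup>-\<^sup>2 e, 0]\<^sup>T\<close>, normalised. It probes \<open>\<xi>\<close>
  before \<open>\<xi>\<close> is known to be nonzero.\<close>

lemma ex_unit_vec_orthogonal_to_walks:
  assumes n: "n > 0" and A: "A \<in> carrier_mat n n"
  shows "\<exists>u. u \<bullet> u = 1 \<and> orthogonal_to_walks n A u"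
proof -
  let ?M = "bordered_walk_mat n A (0\<^sub>v n)"
  have "det ?M\<^sup>T = 0" using n by (simp add: det_transpose[of _ n] det_bordered_walk_mat)
  then obtain v where v: "v \<in> carrier_vec n" "v \<noteq> 0\<^sub>v n" "?M\<^sup>T *\<^sub>v v = 0\<^sub>v n"
    using n det_0_iff_vec_prod_zero[of "?M\<^sup>T" n] by auto
  have orth: "walk_vec n A k \<bullet> v = 0" if "k < n - 1" for k
  proof -
    have "(?M\<^sup>T *\<^sub>v v) $ k = 0" using v(3) that by simp
    thus ?thesis using that A n col_bordered_walk_mat[OF n A, of "0\<^sub>v n" k]
      carrier_matD[OF bordered_walk_mat_carrier[OF n]] by simp
  qed
  have pos: "v \<bullet> v > 0" using scalar_prod_self_pos v(1,2) .
  define c where "c = 1 / sqrt (v \<bullet> v)"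
  have "c * c = 1 / (v \<bullet> v)" using pos unfolding c_def by simp
  hence "c * (c * (v \<bullet> v)) = 1" using pos by (simp flip: mult.assoc)
  hence "(c \<cdot>\<^sub>v v) \<bullet> (c \<cdot>\<^sub>v v) = 1" using v(1) by simp
  moreover have "walk_vec n A k \<bullet> (c \<cdot>\<^sub>v v) = 0" if "k < n - 1" for k
    using orth[OF that] v(1) A by simp
  ultimately show ?thesis using v(1) unfolding orthogonal_to_walks_def
    by (intro exI[of _ "c \<cdot>\<^sub>v v"]) auto
qed

section \<open>Rank of the walk matrix\<close>

lemma rank_sum_outer_products_le:
  fixes b c :: "nat \<Rightarrow> nat \<Rightarrow> 'a :: field"
  shows "vec_space.rank n (mat n m (\<lambda>(r, s). \<Sum>l<k. b l r * c l s)) \<le> k"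
proof -
  interpret vec_space "TYPE('a)" n .
  show ?thesis
  proof (induction k)
    case 0
    have "mat n m (\<lambda>(r, s). \<Sum>l<0. b l r * c l s) = 0\<^sub>m n m" by (rule eq_matI) auto
    thus ?case using rank_0I by (simp only: le_refl)
  next
    case (Suc k)
    let ?A = "\<lambda>k. mat n m (\<lambda>(r, s). \<Sum>l<k. b l r * c l s)" and ?B = "mat n m (\<lambda>(r, s). b k r * c k s)"
    have "?A (Suc k) = ?A k + ?B" by (rule eq_matI) auto
    moreover have "rank ?B \<le> 1" by (rule rank_le_1_product_entries[of _ m "b k" "c k"]) auto
    ultimately show ?case using Suc rank_subadditive[of "?A k" m ?B] by simp
  qed
qed

text \<open>Once \<open>A\<^sup>k e\<close> is a combination of its predecessors, so are all later vectors, because the span of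
  \<open>e, \<dots>, A\<^sup>k\<^sup>-\<^sup>1 e\<close> has become invariant under \<open>A\<close>. The walk matrix is then a sum of \<open>k\<close> outer
  products.\<close>

lemma rank_walk_mat_le:
  assumes n: "n > 0" and A: "A \<in> carrier_mat n n"
    and rel: "\<And>r. r < n \<Longrightarrow> walk_vec n A k $ r = (\<Sum>i<k. a i * walk_vec n A i $ r)"
  shows "vec_space.rank n (bordered_walk_mat n A (walk_vec n A (n - 1))) \<le> k"
proof -
  have "\<exists>c. \<forall>r<n. walk_vec n A j $ r = (\<Sum>i<k. walk_vec n A i $ r * c i)" for j
  proof (induction j)
    case 0
    show ?case
    proof (cases k)
      case 0
      thus ?thesis using rel by auto
    next
      case (Suc k')
      thus ?thesis by (intro exI[of _ "\<lambda>i. if i = 0 then 1 else 0"]) (simp add: sum.lessThan_Suc_shift del: sum.lessThan_Suc)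
    qed
  next
    case (Suc j)
    then obtain c where c: "\<And>r. r < n \<Longrightarrow> walk_vec n A j $ r = (\<Sum>i<k. walk_vec n A i $ r * c i)" by auto
    have idx: "walk_vec n A (Suc i) $ r = (\<Sum>s<n. A $$ (r, s) * walk_vec n A i $ s)" if "r < n" for i r
      unfolding walk_vec_Suc[OF A] using that A by (intro mult_mat_vec_index_sum[of _ n n]) auto
    have "walk_vec n A (Suc j) $ r = (\<Sum>i<k. walk_vec n A (Suc i) $ r * c i)" if r: "r < n" for r
    proof -
      have "walk_vec n A (Suc j) $ r = (\<Sum>s<n. \<Sum>i<k. A $$ (r, s) * walk_vec n A i $ s * c i)"
        unfolding idx[OF r] using c by (simp add: sum_distrib_left mult.assoc)
      also have "\<dots> = (\<Sum>i<k. walk_vec n A (Suc i) $ r * c i)"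
        unfolding idx[OF r] by (subst sum.swap) (simp add: sum_distrib_right)
      finally show ?thesis .
    qed
    note shifted = this
    show ?case
    proof (cases k)
      case 0
      thus ?thesis using shifted by simp
    next
      case (Suc k')
      \<comment> \<open>Applying \<open>A\<close> shifts the combination by one index; the overflowing term \<open>A\<^sup>k e\<close> is expanded again.\<close>
      let ?d = "\<lambda>i. (if i = 0 then 0 else c (i - 1)) + c k' * a i"
      have "walk_vec n A (Suc j) $ r = (\<Sum>i<k. walk_vec n A i $ r * ?d i)" if r: "r < n" for r
      proof -
        have "walk_vec n A (Suc j) $ r = (\<Sum>i<k'. walk_vec n A (Suc i) $ r * c i) + walk_vec n A k $ r * c k'"
          using shifted[OF r] Suc by simp
        also have "(\<Sum>i<k'. walk_vec n A (Suc i) $ r * c i)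
            = (\<Sum>i<k. walk_vec n A i $ r * (if i = 0 then 0 else c (i - 1)))"
          unfolding Suc by (subst sum.lessThan_Suc_shift) simp
        also have "walk_vec n A k $ r * c k' = (\<Sum>i<k. walk_vec n A i $ r * (c k' * a i))"
          unfolding rel[OF r] sum_distrib_right by (simp add: mult_ac)
        finally show ?thesis by (simp add: sum.distrib distrib_left)
      qed
      thus ?thesis by (intro exI[of _ ?d]) auto
    qed
  qed
  then obtain c where c: "\<And>j r. r < n \<Longrightarrow> walk_vec n A j $ r = (\<Sum>i<k. walk_vec n A i $ r * c j i)" by metis
  have "bordered_walk_mat n A (walk_vec n A (n - 1)) = mat n n (\<lambda>(r, s). \<Sum>l<k. walk_vec n A l $ r * c s l)"
    by (rule eq_matI) (use n in \<open>auto simp: index_bordered_walk_mat c[symmetric]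
       carrier_matD[OF bordered_walk_mat_carrier]\<close>)
  thus ?thesis using rank_sum_outer_products_le[where n = n and m = n and k = k and b = "\<lambda>l r. walk_vec n A l $ r" and c = "\<lambda>l s. c s l"] by simp
qed

text \<open>If \<open>\<xi> = 0\<close>, then \<open>[e, \<dots>, A\<^sup>n\<^sup>-\<^sup>2 e, u]\<close> is singular even for a unit vector \<open>u\<close> orthogonal to
  the other columns, so these satisfy a linear relation. Its last nonzero coefficient expresses some
  \<open>A\<^sup>k e\<close>, \<open>k \<le> n - 2\<close>, through its predecessors, which bounds the rank of the walk matrix by
  \<open>n - 2\<close>.\<close>

lemma cofactor_vec_nonzero:
  assumes n: "n > 0" and A: "A \<in> carrier_mat n n"
    and rank: "vec_space.rank n (bordered_walk_mat n A (walk_vec n A (n - 1))) + 1 = n"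
  shows "cofactor_vec n A \<noteq> 0\<^sub>v n"
proof
  assume z: "cofactor_vec n A = 0\<^sub>v n"
  obtain u where u: "u \<in> carrier_vec n" "u \<bullet> u = 1" "\<And>k. k < n - 1 \<Longrightarrow> walk_vec n A k \<bullet> u = 0"
    using ex_unit_vec_orthogonal_to_walks[OF n A] unfolding orthogonal_to_walks_def by auto
  let ?M = "bordered_walk_mat n A u"
  have M: "?M \<in> carrier_mat n n" using n by simp
  have "det ?M = 0" using z u n by (simp add: det_bordered_walk_mat)
  then obtain x where x: "x \<in> carrier_vec n" "x \<noteq> 0\<^sub>v n" "?M *\<^sub>v x = 0\<^sub>v n"
    using det_0_iff_vec_prod_zero[OF M] by auto
  obtain m where m: "n = Suc m" using n by (cases n) auto
  have Mx: "(\<Sum>j<m. walk_vec n A j $ r * x $ j) + u $ r * x $ m = 0" if r: "r < n" for r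
  proof -
    have "0 = (?M *\<^sub>v x) $ r" using x(3) r by simp
    also have "\<dots> = (\<Sum>j<n. ?M $$ (r, j) * x $ j)" 
      by (rule mult_mat_vec_index_sum[OF M x(1) r])
    also have "\<dots> = (\<Sum>j<m. walk_vec n A j $ r * x $ j) + u $ r * x $ m"
      using r n by (simp add: index_bordered_walk_mat m)
    finally show ?thesis by simp
  qed
  \<comment> \<open>Pairing the relation with \<open>u\<close> isolates the coefficient of \<open>u\<close>.\<close>
  have wu: "walk_vec n A j \<bullet> u = (\<Sum>r<n. u $ r * walk_vec n A j $ r)" for j
    using u(1) by (simp add: scalar_prod_def atLeast0LessThan mult.commute)
  have swap: "(\<Sum>r<n. \<Sum>j<m. u $ r * walk_vec n A j $ r * x $ j)
     = (\<Sum>j<m. (walk_vec n A j \<bullet> u) * x $ j)"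
    unfolding wu sum_distrib_right by (rule sum.swap)
  have uu: "(\<Sum>r<n. u $ r * u $ r * x $ m) = (u \<bullet> u) * x $ m"
    using u(1) unfolding sum_distrib_right[symmetric] by (simp add: scalar_prod_def atLeast0LessThan)
  have "0 = (\<Sum>r<n. u $ r * ((\<Sum>j<m. walk_vec n A j $ r * x $ j) + u $ r * x $ m))"
    by (rule sum.neutral[symmetric]) (use Mx in auto)
  also have "\<dots> = (\<Sum>r<n. (\<Sum>j<m. u $ r * walk_vec n A j $ r * x $ j) + u $ r * u $ r * x $ m)"
    by (simp only: distrib_left sum_distrib_left mult.assoc)
  also have "\<dots> = (\<Sum>j<m. (walk_vec n A j \<bullet> u) * x $ j) + (u \<bullet> u) * x $ m"
    unfolding sum.distrib swap uu ..
  also have "\<dots> = x $ m" using u(2,3) m by simp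
  finally have xm: "x $ m = 0" by simp
  have "\<exists>j<m. x $ j \<noteq> 0"
  proof (rule ccontr)
    assume "\<not> ?thesis"
    hence "x $ j = 0" if "j < n" for j using xm that m by (cases "j = m") auto
    hence "x = 0\<^sub>v n" using x(1) by (intro eq_vecI) auto
    thus False using x(2) by simp
  qed
  define k where "k = Max {j. j < m \<and> x $ j \<noteq> 0}"
  have "k \<in> {j. j < m \<and> x $ j \<noteq> 0}" unfolding k_def using \<open>\<exists>j<m. x $ j \<noteq> 0\<close> by (intro Max_in) auto
  hence k: "k < m" "x $ k \<noteq> 0" by auto
  have above: "x $ j = 0" if "k < j" "j < m" for j
  proof (rule ccontr)
    assume "x $ j \<noteq> 0"
    hence "j \<le> k" unfolding k_def using that by (intro Max_ge) auto
    thus False using that by simp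
  qed
  have "walk_vec n A k $ r = (\<Sum>i<k. (- x $ i / x $ k) * walk_vec n A i $ r)" if r: "r < n" for r
  proof -
    have "0 = (\<Sum>j<m. walk_vec n A j $ r * x $ j)" using Mx[OF r] xm by simp
    also have "\<dots> = (\<Sum>j<Suc k. walk_vec n A j $ r * x $ j)"
      by (rule sum.mono_neutral_right) (use k above in auto)
    finally have "walk_vec n A k $ r * x $ k = - (\<Sum>j<k. walk_vec n A j $ r * x $ j)" by simp
    hence "walk_vec n A k $ r = - (\<Sum>j<k. walk_vec n A j $ r * x $ j) / x $ k" 
      using nonzero_eq_divide_eq[OF k(2)] by blast
    also have "\<dots> = (\<Sum>i<k. (- x $ i / x $ k) * walk_vec n A i $ r)"
      by (simp add: sum_divide_distrib sum_negf mult.commute)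
    finally show ?thesis .
  qed
  from rank_walk_mat_le[OF n A this] rank k(1) m show False by linarith
qed

section \<open>Vectors orthogonal to the walk vectors\<close>

text \<open>Subtract from \<open>u\<close> its projection to \<open>\<xi>\<close>: the difference is orthogonal to all columns of
  \<open>[e, \<dots>, A\<^sup>n\<^sup>-\<^sup>2 e, \<xi>]\<close>, a matrix of determinant \<open>\<xi> \<bullet> \<xi> \<noteq> 0\<close>.\<close>

lemma orthogonal_to_walks_imp_multiple:
  assumes n: "n > 0" and A: "A \<in> carrier_mat n n" and nz: "cofactor_vec n A \<noteq> 0\<^sub>v n"
    and u: "orthogonal_to_walks n A u"
  shows "\<exists>s. u = s \<cdot>\<^sub>v cofactor_vec n A"
proof -
  let ?\<xi> = "cofactor_vec n A"
  note orth = orthogonal_to_walks_cofactor_vec[OF A]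
  note uc = orthogonal_to_walksD(1)[OF u A]
  have pos: "?\<xi> \<bullet> ?\<xi> > 0" using nz by (intro scalar_prod_self_pos[of _ n]) auto
  define s where "s = (?\<xi> \<bullet> u) / (?\<xi> \<bullet> ?\<xi>)"
  define z where "z = u - s \<cdot>\<^sub>v ?\<xi>"
  let ?M = "bordered_walk_mat n A ?\<xi>"
  have M: "?M \<in> carrier_mat n n" using n by simp
  have z: "z \<in> carrier_vec n" unfolding z_def using uc by simp
  have zM: "col ?M j \<bullet> z = 0" if "j < n" for j
  proof (cases "j = n - 1")
    case True
    have "?\<xi> \<bullet> z = ?\<xi> \<bullet> u - s * (?\<xi> \<bullet> ?\<xi>)" unfolding z_def using uc
      by (simp add: scalar_prod_minus_distrib[of _ n])
    thus ?thesis using True that pos A n by (simp add: col_bordered_walk_mat s_def)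
  next
    case False
    hence j: "j < n - 1" using that by simp
    have "walk_vec n A j \<bullet> z = walk_vec n A j \<bullet> u - s * (walk_vec n A j \<bullet> ?\<xi>)" unfolding z_def
      using uc A by (simp add: scalar_prod_minus_distrib[of _ n])
    thus ?thesis using that j A n orthogonal_to_walksD(2)[OF u A j] orthogonal_to_walksD(2)[OF orth A j]
      by (simp add: col_bordered_walk_mat)
  qed
  have "?M\<^sup>T *\<^sub>v z = 0\<^sub>v n" by (rule eq_vecI) (use carrier_matD[OF M] zM in simp_all)
  moreover have "det ?M\<^sup>T \<noteq> 0" using pos n M by (simp add: det_transpose[of _ n] det_bordered_walk_mat)
  ultimately have "z = 0\<^sub>v n" using z M det_0_iff_vec_prod_zero[of "?M\<^sup>T" n] by auto
  hence z0: "z $ i = 0" if "i < n" for i using that by simp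
  have "u $ i = (s \<cdot>\<^sub>v ?\<xi>) $ i" if "i < n" for i
    using z0[OF that] that uc unfolding z_def by simp
  hence "u = s \<cdot>\<^sub>v ?\<xi>" using uc by (intro eq_vecI) auto
  thus ?thesis ..
qed

text \<open>Symmetry moves the powers of \<open>A\<close> to one side: inner products of walk vectors are walk counts.\<close>

lemma walk_vec_scalar_prod:
  assumes A: "A \<in> carrier_mat n n" and sym: "A\<^sup>T = A"
  shows "walk_vec n A i \<bullet> walk_vec n A j = (\<Sum>r<n. walk_vec n A (i + j) $ r)"
proof (induction i arbitrary: j)
  case 0
  show ?case using A walk_vec_carrier[OF A, of j]
    by (simp add: walk_vec_0 ones_vec_def scalar_prod_def atLeast0LessThan)
next
  case (Suc i)
  have "walk_vec n A (Suc i) \<bullet> walk_vec n A j = (A\<^sup>T *\<^sub>v walk_vec n A i) \<bullet> walk_vec n A j"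
    by (simp add: walk_vec_Suc[OF A] sym)
  also have "\<dots> = walk_vec n A i \<bullet> walk_vec n A (Suc j)"
    using A by (subst transpose_vec_mult_scalar[of _ n n]) (auto simp: walk_vec_Suc)
  finally show ?case using Suc by simp
qed

section \<open>Symmetric matrices with equal walk counts\<close>

text \<open>What the argument needs to know about the adjacency matrices of two generalized cospectral
  graphs. The last two assumptions say that the walk matrix of \<open>A\<close> has rank \<open>n - 1\<close>: its first
  \<open>n - 1\<close> columns are independent, its determinant vanishes.\<close>

locale equal_walk_counts =
  fixes n :: nat and A B :: "real mat"
  assumes A: "A \<in> carrier_mat n n" and B: "B \<in> carrier_mat n n"
    and sym_A: "A\<^sup>T = A" and sym_B: "B\<^sup>T = B"
    and trace_eq: "(\<Sum>i<n. A $$ (i, i)) = (\<Sum>i<n. B $$ (i, i))"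
    and counts: "\<And>k. (\<Sum>i<n. walk_vec n A k $ i) = (\<Sum>i<n. walk_vec n B k $ i)"
    and n: "n > 0"
    and nonzero_A: "cofactor_vec n A \<noteq> 0\<^sub>v n"
    and last_A: "cofactor_vec n A \<bullet> walk_vec n A (n - 1) = 0"
begin

text \<open>For \<open>n = 1\<close> the last walk vector is \<open>e\<close> itself, and a nonzero \<open>\<xi>\<close> with a single entry is
  not orthogonal to it. So \<open>e\<close> is always
  among the first \<open>n - 1\<close> columns.\<close>

lemma n_ge_2: "n \<ge> 2"
proof (rule ccontr)
  assume "\<not> ?thesis"
  hence n1: "n = 1" using n by simp
  have "cofactor_vec n A $ 0 = 0"
    using last_A A by (simp add: n1 walk_vec_0 ones_vec_def scalar_prod_def)
  hence "cofactor_vec n A = 0\<^sub>v n" using cofactor_vec_carrier[of n A] n1 by (intro eq_vecI) auto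
  thus False using nonzero_A by simp
qed

lemma walk_gram_eq: "walk_vec n A i \<bullet> walk_vec n A j = walk_vec n B i \<bullet> walk_vec n B j"
  using walk_vec_scalar_prod[OF A sym_A] walk_vec_scalar_prod[OF B sym_B] counts by simp

lemma gram_mat_eq:
  assumes u: "u \<in> carrier_vec n" and v: "v \<in> carrier_vec n" and uv: "u \<bullet> u = v \<bullet> v"
    and w: "\<And>k. k < n - 1 \<Longrightarrow> walk_vec n A k \<bullet> u = walk_vec n B k \<bullet> v"
  shows "(bordered_walk_mat n A u)\<^sup>T * bordered_walk_mat n A u
    = (bordered_walk_mat n B v)\<^sup>T * bordered_walk_mat n B v"
proof (rule eq_matI)
  let ?M = "bordered_walk_mat n A u" and ?N = "bordered_walk_mat n B v"
  have M: "?M \<in> carrier_mat n n" and N: "?N \<in> carrier_mat n n" using n by auto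
  note dims = carrier_matD[OF M] carrier_matD[OF N]
  have w': "u \<bullet> walk_vec n A k = v \<bullet> walk_vec n B k" if "k < n - 1" for k
    using w[OF that] comm_scalar_prod[OF u walk_vec_carrier[OF A]]
      comm_scalar_prod[OF v walk_vec_carrier[OF B]] by simp
  fix i j assume "i < dim_row (?N\<^sup>T * ?N)" "j < dim_col (?N\<^sup>T * ?N)"
  hence ij: "i < n" "j < n" using dims by auto
  have "(?M\<^sup>T * ?M) $$ (i, j) = col ?M i \<bullet> col ?M j" using ij dims by simp
  also have "\<dots> = col ?N i \<bullet> col ?N j"
    using ij uv w w' walk_gram_eq by (simp add: col_bordered_walk_mat[OF n A u] col_bordered_walk_mat[OF n B v])
  also have "\<dots> = (?N\<^sup>T * ?N) $$ (i, j)" using ij dims by simp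
  finally show "(?M\<^sup>T * ?M) $$ (i, j) = (?N\<^sup>T * ?N) $$ (i, j)" .
qed (use n in \<open>simp_all add: carrier_matD[OF bordered_walk_mat_carrier]\<close>)

text \<open>Both sides are squares of determinants of bordered walk matrices, that is, Gram determinants.\<close>

lemma cofactor_prod_square_eq:
  assumes u: "u \<in> carrier_vec n" and v: "v \<in> carrier_vec n" and uv: "u \<bullet> u = v \<bullet> v"
    and w: "\<And>k. k < n - 1 \<Longrightarrow> walk_vec n A k \<bullet> u = walk_vec n B k \<bullet> v"
  shows "(cofactor_vec n A \<bullet> u)\<^sup>2 = (cofactor_vec n B \<bullet> v)\<^sup>2"
proof -
  have "det (X\<^sup>T * X) = (det X)\<^sup>2" if "X \<in> carrier_mat n n" for X :: "real mat"
    using that det_mult[of "X\<^sup>T" n X] det_transpose[of X n] by (simp add: power2_eq_square)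
  from this[of "bordered_walk_mat n A u"] this[of "bordered_walk_mat n B v"] gram_mat_eq[OF assms]
  show ?thesis using n u v by (simp add: det_bordered_walk_mat)
qed

text \<open>Singularity of the walk matrix is visible in its Gram determinant.\<close>

lemma last_B: "cofactor_vec n B \<bullet> walk_vec n B (n - 1) = 0"
  using cofactor_prod_square_eq[of "walk_vec n A (n - 1)" "walk_vec n B (n - 1)"] A B walk_gram_eq last_A
  by simp

text \<open>For \<open>v\<close> orthogonal to the walk vectors of \<open>B\<close>, comparing Gram determinants with the multiple of
  \<open>\<xi>(A)\<close> of the same length as \<open>v\<close> gives \<open>|\<xi>(A)|\<^sup>2 |v|\<^sup>2 = (\<xi>(B) \<bullet> v)\<^sup>2\<close>. A unit vector \<open>v\<close> shows that
  \<open>\<xi>(B)\<close> is nonzero, and then \<open>v = \<xi>(B)\<close> gives the claim.\<close>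

lemma cofactor_vec_norm_eq:
  "cofactor_vec n B \<bullet> cofactor_vec n B = cofactor_vec n A \<bullet> cofactor_vec n A"
proof -
  let ?a = "cofactor_vec n A" and ?b = "cofactor_vec n B"
  have pos: "?a \<bullet> ?a > 0" using nonzero_A by (intro scalar_prod_self_pos[of _ n]) auto
  have key: "(?a \<bullet> ?a)\<^sup>2 * (v \<bullet> v) = (?a \<bullet> ?a) * (?b \<bullet> v)\<^sup>2" if v: "orthogonal_to_walks n B v" for v
  proof -
    note vc = orthogonal_to_walksD(1)[OF v B]
    have vv: "v \<bullet> v \<ge> 0" using vc by (auto simp: scalar_prod_def intro!: sum_nonneg)
    define c where "c = sqrt ((v \<bullet> v) / (?a \<bullet> ?a))"
    have c: "c * c = (v \<bullet> v) / (?a \<bullet> ?a)" unfolding c_def using vv pos by simp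
    note ac = orthogonal_to_walks_smult[OF orthogonal_to_walks_cofactor_vec[OF A] A, of c]
    have "(?a \<bullet> (c \<cdot>\<^sub>v ?a))\<^sup>2 = (?b \<bullet> v)\<^sup>2"
    proof (rule cofactor_prod_square_eq)
      have "(c \<cdot>\<^sub>v ?a) \<bullet> (c \<cdot>\<^sub>v ?a) = c * c * (?a \<bullet> ?a)" by simp
      thus "(c \<cdot>\<^sub>v ?a) \<bullet> (c \<cdot>\<^sub>v ?a) = v \<bullet> v" using c pos by simp
    qed (use vc orthogonal_to_walksD(2)[OF ac A] orthogonal_to_walksD(2)[OF v B] in auto)
    hence "(c * c) * (?a \<bullet> ?a)\<^sup>2 = (?b \<bullet> v)\<^sup>2" by (simp add: power2_eq_square mult_ac)
    thus ?thesis using pos unfolding c by (simp add: field_simps power2_eq_square)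
  qed
  obtain u where u: "u \<bullet> u = 1" "orthogonal_to_walks n B u"
    using ex_unit_vec_orthogonal_to_walks[OF n B] by auto
  have "?b \<bullet> u \<noteq> 0" using key[OF u(2)] u(1) pos by auto
  hence nb: "?b \<noteq> 0\<^sub>v n" using orthogonal_to_walksD(1)[OF u(2) B] by auto
  have posb: "?b \<bullet> ?b > 0" using nb by (intro scalar_prod_self_pos[of _ n]) auto
  have "(?a \<bullet> ?a) * (?b \<bullet> ?b) * (?a \<bullet> ?a) = (?a \<bullet> ?a) * (?b \<bullet> ?b) * (?b \<bullet> ?b)"
    using key[OF orthogonal_to_walks_cofactor_vec[OF B]] by (simp add: power2_eq_square mult_ac)
  thus ?thesis using pos posb by simp
qed

lemma nonzero_B: "cofactor_vec n B \<noteq> 0\<^sub>v n"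
  using cofactor_vec_norm_eq scalar_prod_self_pos[OF cofactor_vec_carrier nonzero_A] by auto

section \<open>The orthogonal matrices conjugating one matrix to the other\<close>

text \<open>Here \<open>P\<close> is the inverse of \<open>N = [e, \<dots>, B\<^sup>n\<^sup>-\<^sup>2 e, c \<xi>(B)]\<close> and \<open>s\<close> is a sign. Equality of the
  Gram matrices of \<open>M\<close> and \<open>N\<close> makes \<open>Q = M P\<close> orthogonal. For the conjugation identity,
  \<open>M\<^sup>T A M\<close> and \<open>N\<^sup>T B N\<close> have equal walk counts as entries, and zeros in the last row and column
  off the diagonal; the remaining entry, which involves \<open>\<xi> \<bullet> A \<xi>\<close>, is settled by the trace.\<close>

lemma
  assumes c: "c \<noteq> 0" and P: "bordered_walk_mat n B (c \<cdot>\<^sub>v cofactor_vec n B) * P = 1\<^sub>m n"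
    "P \<in> carrier_mat n n" and s: "s * s = 1"
  defines "Q \<equiv> bordered_walk_mat n A ((s * c) \<cdot>\<^sub>v cofactor_vec n A) * P"
  shows solution_in_RO: "Q \<in> RO n" and solution_conjugates: "Q\<^sup>T * A * Q = B"
proof -
  let ?u = "(s * c) \<cdot>\<^sub>v cofactor_vec n A" and ?v = "c \<cdot>\<^sub>v cofactor_vec n B"
  define M where "M = bordered_walk_mat n A ?u"
  define N where "N = bordered_walk_mat n B ?v"
  have Q: "Q = M * P" unfolding Q_def M_def ..
  note u = orthogonal_to_walks_smult[OF orthogonal_to_walks_cofactor_vec[OF A] A, of "s * c"]
  note v = orthogonal_to_walks_smult[OF orthogonal_to_walks_cofactor_vec[OF B] B, of c]
  note uc = orthogonal_to_walksD(1)[OF u A] note vc = orthogonal_to_walksD(1)[OF v B]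
  have M [simp]: "M \<in> carrier_mat n n" and N [simp]: "N \<in> carrier_mat n n" unfolding M_def N_def using n by auto
  note [simp] = P(2) A B mult_carrier_mat[of _ n n _ n] left_mult_one_mat[of _ n n] right_mult_one_mat[of _ n n]
  have Qc [simp]: "Q \<in> carrier_mat n n" unfolding Q by simp
  have NP: "N * P = 1\<^sub>m n" using P(1) unfolding N_def .
  have PN: "P * N = 1\<^sub>m n" using mat_mult_left_right_inverse[OF N P(2) NP] .
  have PtNt: "P\<^sup>T * N\<^sup>T = 1\<^sub>m n" using NP transpose_mult[of N n n P n] by simp
  have QN: "Q * N = M" unfolding Q using PN by (simp add: assoc_mult_mat[of _ n n _ n _ n])
  have Qt: "Q\<^sup>T = P\<^sup>T * M\<^sup>T" unfolding Q using transpose_mult[of M n n P n] by simp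
  have "?u \<bullet> ?u = (s * s) * (c * c) * (cofactor_vec n A \<bullet> cofactor_vec n A)" by (simp add: mult_ac)
  hence uv: "?u \<bullet> ?u = ?v \<bullet> ?v" using s cofactor_vec_norm_eq by simp
  have gram: "M\<^sup>T * M = N\<^sup>T * N" unfolding M_def N_def
    by (rule gram_mat_eq[OF uc vc uv])
      (simp only: orthogonal_to_walksD(2)[OF u A] orthogonal_to_walksD(2)[OF v B])
  have "Q\<^sup>T * Q = P\<^sup>T * (M\<^sup>T * M) * P" unfolding Qt unfolding Q
    by (simp add: assoc_mult_mat[of _ n n _ n _ n])
  also have "\<dots> = P\<^sup>T * N\<^sup>T * (N * P)" unfolding gram
    by (simp add: assoc_mult_mat[of _ n n _ n _ n])
  finally have QtQ: "Q\<^sup>T * Q = 1\<^sub>m n" using NP PtNt by simp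
  have QQt: "Q * Q\<^sup>T = 1\<^sub>m n" by (rule mat_mult_left_right_inverse[of _ n]) (use QtQ in auto)
  have "col M 0 = ones_vec n" "col N 0 = ones_vec n" unfolding M_def N_def
    using n_ge_2 uc vc by (auto simp: col_bordered_walk_mat walk_vec_0)
  moreover have "col M 0 = Q *\<^sub>v col N 0"
    unfolding QN[symmetric] by (rule col_mult2[of _ n n _ n]) (use n in auto)
  ultimately have "Q *\<^sub>v ones_vec n = ones_vec n" by simp
  thus "Q \<in> RO n" unfolding RO_def using QtQ QQt by simp

  \<comment> \<open>\<open>E\<close> is the possible discrepancy, \<open>t\<close> its only nonzero entry.\<close>
  define t where "t = ?u \<bullet> (A *\<^sub>v ?u) - ?v \<bullet> (B *\<^sub>v ?v)"
  define E where "E = mat n n (\<lambda>(i, j). if i = n - 1 \<and> j = n - 1 then t else 0)"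
  have E [simp]: "E \<in> carrier_mat n n" unfolding E_def by simp
  \<comment> \<open>The index \<open>Suc k = n - 1\<close> is included: there the vanishing of the full walk determinant enters.\<close>
  have walks_last: "walk_vec n A (Suc k) \<bullet> ?u = 0" "walk_vec n B (Suc k) \<bullet> ?v = 0" if "k < n - 1" for k
  proof -
    have "cofactor_vec n A \<bullet> walk_vec n A (Suc k) = 0" "cofactor_vec n B \<bullet> walk_vec n B (Suc k) = 0"
      using that cofactor_vec_orthogonal[OF A, of "Suc k"] cofactor_vec_orthogonal[OF B, of "Suc k"]
        last_A last_B by (cases "Suc k = n - 1"; simp)+
    thus "walk_vec n A (Suc k) \<bullet> ?u = 0" "walk_vec n B (Suc k) \<bullet> ?v = 0"
      using comm_scalar_prod[OF cofactor_vec_carrier walk_vec_carrier] by simp_all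
  qed
  have form: "M\<^sup>T * A * M = N\<^sup>T * B * N + E"
  proof (rule eq_matI)
    fix i j assume "i < dim_row (N\<^sup>T * B * N + E)" "j < dim_col (N\<^sup>T * B * N + E)"
    hence ij: "i < n" "j < n" using carrier_matD[OF E] by auto
    have entry: "(X\<^sup>T * Y * X) $$ (i, j) = col X i \<bullet> (Y *\<^sub>v col X j)"
      if X: "X \<in> carrier_mat n n" and Y: "Y \<in> carrier_mat n n" for X Y :: "real mat"
    proof -
      have "X\<^sup>T * Y * X = X\<^sup>T * (Y * X)" using X Y by (simp add: assoc_mult_mat[of _ n n _ n _ n])
      moreover have "(X\<^sup>T * (Y * X)) $$ (i, j) = col X i \<bullet> col (Y * X) j"
        using ij X Y carrier_matD[OF X] by simp
      ultimately show ?thesis using col_mult2[OF Y X ij(2)] by simp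
    qed
    have move: "x \<bullet> (Y *\<^sub>v y) = (Y *\<^sub>v x) \<bullet> y"
      if "Y\<^sup>T = Y" "Y \<in> carrier_mat n n" "x \<in> carrier_vec n" "y \<in> carrier_vec n" for Y :: "real mat" and x y
      using transpose_vec_mult_scalar[of Y n n y x] that by simp
    have comm: "?u \<bullet> walk_vec n A k = walk_vec n A k \<bullet> ?u" "?v \<bullet> walk_vec n B k = walk_vec n B k \<bullet> ?v" for k
      using comm_scalar_prod[OF uc walk_vec_carrier[OF A]] comm_scalar_prod[OF vc walk_vec_carrier[OF B]] by auto
    note cols = col_bordered_walk_mat[OF n A uc] col_bordered_walk_mat[OF n B vc]
    have "col M i \<bullet> (A *\<^sub>v col M j) = col N i \<bullet> (B *\<^sub>v col N j) + E $$ (i, j)"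
    proof (cases "j = n - 1")
      case False
      hence j: "j < n - 1" using ij by simp
      have "?u \<bullet> walk_vec n A (Suc j) = ?v \<bullet> walk_vec n B (Suc j)"
        unfolding comm walks_last[OF j] ..
      thus ?thesis using False ij walk_gram_eq[of i "Suc j"] unfolding M_def N_def E_def
        by (simp add: cols walk_vec_Suc[OF A, symmetric] walk_vec_Suc[OF B, symmetric]
          del: smult_scalar_prod_distrib scalar_prod_smult_left)
    next
      case j: True
      show ?thesis
      proof (cases "i = n - 1")
        case True
        thus ?thesis using ij j unfolding M_def N_def E_def t_def by (simp add: cols)
      next
        case False
        have "walk_vec n A i \<bullet> (A *\<^sub>v ?u) = 0" "walk_vec n B i \<bullet> (B *\<^sub>v ?v) = 0"
          using False ij walks_last[of i] move[OF sym_A A walk_vec_carrier[OF A] uc]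
            move[OF sym_B B walk_vec_carrier[OF B] vc]
          by (simp_all add: walk_vec_Suc[OF A, symmetric] walk_vec_Suc[OF B, symmetric])
        thus ?thesis using ij j False unfolding M_def N_def E_def by (simp add: cols)
      qed
    qed
    thus "(M\<^sup>T * A * M) $$ (i, j) = (N\<^sup>T * B * N + E) $$ (i, j)"
      using ij carrier_matD[OF E] entry[OF M A] entry[OF N B] by simp
  qed (use carrier_matD[OF M] carrier_matD[OF N] carrier_matD[OF E] in auto)
  have "Q\<^sup>T * A * Q = P\<^sup>T * (M\<^sup>T * A * M) * P" unfolding Qt unfolding Q
    by (simp add: assoc_mult_mat[of _ n n _ n _ n])
  also have "\<dots> = P\<^sup>T * (N\<^sup>T * B * N) * P + P\<^sup>T * E * P" unfolding form
    by (simp add: mult_add_distrib_mat[of _ n n _ n] add_mult_distrib_mat[of _ n n _ _ n])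
  also have "P\<^sup>T * (N\<^sup>T * B * N) * P = (P\<^sup>T * N\<^sup>T) * B * (N * P)"
    by (simp add: assoc_mult_mat[of _ n n _ n _ n])
  also have "\<dots> = B" unfolding PtNt NP by simp
  finally have QAQ: "Q\<^sup>T * A * Q = B + P\<^sup>T * E * P" .
  have diag: "(P\<^sup>T * E * P) $$ (i, i) = t * (P $$ (n - 1, i))\<^sup>2" if i: "i < n" for i
  proof -
    have "(P\<^sup>T * E) $$ (i, j) = (if j = n - 1 then P $$ (n - 1, i) * t else 0)" if "j < n" for j
    proof -
      have "(P\<^sup>T * E) $$ (i, j) = (\<Sum>k<n. P $$ (k, i) * E $$ (k, j))"
        using i that carrier_matD[OF P(2)] carrier_matD[OF E] by (simp add: scalar_prod_def atLeast0LessThan)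
      also have "\<dots> = (\<Sum>k<n. if k = n - 1 then (if j = n - 1 then P $$ (k, i) * t else 0) else 0)"
        by (rule sum.cong) (use that in \<open>auto simp: E_def\<close>)
      finally show ?thesis using n by simp
    qed
    hence "(P\<^sup>T * E * P) $$ (i, i) = (\<Sum>k<n. (if k = n - 1 then P $$ (n - 1, i) * t else 0) * P $$ (k, i))"
      using i carrier_matD[OF P(2)] carrier_matD[OF E]
      by (simp add: scalar_prod_def atLeast0LessThan del: index_mult_mat(1) add: index_mult_mat(1)[of i "P\<^sup>T * E" i P])
    also have "\<dots> = (\<Sum>k<n. if k = n - 1 then P $$ (n - 1, i) * t * P $$ (k, i) else 0)"
      by (rule sum.cong) auto
    finally show ?thesis using n by (simp add: power2_eq_square mult_ac)
  qed
  \<comment> \<open>The trace is invariant under conjugation by \<open>Q\<close>, so the discrepancy, which is \<open>t\<close> times the square norm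
    of the last row of \<open>P\<close>, is zero.\<close>
  have "(\<Sum>i<n. (Q\<^sup>T * A * Q) $$ (i, i)) = (\<Sum>i<n. (Q * (Q\<^sup>T * A)) $$ (i, i))"
    by (rule trace_mult_commute) auto
  also have "Q * (Q\<^sup>T * A) = A" using QQt by (simp add: assoc_mult_mat[of _ n n _ n _ n, symmetric])
  finally have "(\<Sum>i<n. A $$ (i, i)) = (\<Sum>i<n. (B + P\<^sup>T * E * P) $$ (i, i))" unfolding QAQ ..
  also have "\<dots> = (\<Sum>i<n. B $$ (i, i) + t * (P $$ (n - 1, i))\<^sup>2)"
    by (rule sum.cong) (use carrier_matD[OF P(2)] diag in \<open>simp_all del: index_mult_mat(1)\<close>)
  finally have t0: "t * (\<Sum>i<n. (P $$ (n - 1, i))\<^sup>2) = 0"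
    using trace_eq by (simp add: sum.distrib sum_distrib_left)
  have "t = 0"
  proof (rule ccontr)
    assume "t \<noteq> 0"
    hence "\<forall>i\<in>{..<n}. (P $$ (n - 1, i))\<^sup>2 = 0"
      using t0 by (subst sum_nonneg_eq_0_iff[symmetric]) auto
    hence "row P (n - 1) = 0\<^sub>v n" using carrier_matD[OF P(2)] n by (intro eq_vecI) auto
    hence "(P * N) $$ (n - 1, n - 1) = 0" using n carrier_matD[OF P(2)] carrier_matD[OF N]
      by (simp add: scalar_prod_def)
    thus False unfolding PN using n by simp
  qed
  hence "E = 0\<^sub>m n n" unfolding E_def by (intro eq_matI) auto
  thus "Q\<^sup>T * A * Q = B" unfolding QAQ
    by (simp add: left_mult_zero_mat[of _ n n] right_mult_zero_mat[of _ n n])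
qed

text \<open>A solution intertwines \<open>B\<close> and \<open>A\<close> and fixes \<open>e\<close>, so it maps \<open>B\<^sup>k e\<close> to \<open>A\<^sup>k e\<close>. Being an isometry, it
  carries \<open>\<xi>(B)\<close> to a vector orthogonal to all \<open>A\<^sup>k e\<close> with \<open>k \<le> n - 2\<close> and as long as \<open>\<xi>(A)\<close>, that is,
  to \<open>\<plusminus>\<xi>(A)\<close>. This fixes its values on the columns of the invertible matrix \<open>[e, \<dots>, B\<^sup>n\<^sup>-\<^sup>2 e, c \<xi>(B)]\<close>.\<close>

lemma solution_form:
  assumes P: "bordered_walk_mat n B (c \<cdot>\<^sub>v cofactor_vec n B) * P = 1\<^sub>m n" "P \<in> carrier_mat n n"
    and Q: "Q \<in> RO n" and eq: "Q\<^sup>T * A * Q = B"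
  shows "\<exists>s\<in>{1, -1}. Q = bordered_walk_mat n A ((s * c) \<cdot>\<^sub>v cofactor_vec n A) * P"
proof -
  let ?a = "cofactor_vec n A" and ?b = "cofactor_vec n B"
  have Qc: "Q \<in> carrier_mat n n" and QtQ: "Q\<^sup>T * Q = 1\<^sub>m n" and QQt: "Q * Q\<^sup>T = 1\<^sub>m n"
    and Qe: "Q *\<^sub>v ones_vec n = ones_vec n" using Q unfolding RO_def by auto
  note [simp] = Qc A B mult_mat_vec_carrier[OF Qc] mult_carrier_mat[of _ n n _ n] left_mult_one_mat[of _ n n] right_mult_one_mat[of _ n n]
  have "Q * B = (Q * Q\<^sup>T) * A * Q" unfolding eq[symmetric] by (simp add: assoc_mult_mat[of _ n n _ n _ n])
  hence QB: "Q * B = A * Q" unfolding QQt by simp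
  have walks: "Q *\<^sub>v walk_vec n B k = walk_vec n A k" for k
  proof (induction k)
    case (Suc k)
    have "Q *\<^sub>v walk_vec n B (Suc k) = (Q * B) *\<^sub>v walk_vec n B k"
      by (simp add: walk_vec_Suc assoc_mult_mat_vec[of _ n n _ n])
    also have "\<dots> = A *\<^sub>v (Q *\<^sub>v walk_vec n B k)"
      unfolding QB by (simp add: assoc_mult_mat_vec[of _ n n _ n])
    finally show ?case using Suc by (simp add: walk_vec_Suc)
  qed (simp add: walk_vec_0 Qe)
  have iso: "(Q *\<^sub>v x) \<bullet> (Q *\<^sub>v y) = x \<bullet> y" if "x \<in> carrier_vec n" "y \<in> carrier_vec n" for x y
  proof -
    have "(Q *\<^sub>v x) \<bullet> (Q *\<^sub>v y) = (Q\<^sup>T *\<^sub>v (Q *\<^sub>v x)) \<bullet> y"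
      using that by (subst transpose_vec_mult_scalar[of _ n n]) auto
    also have "Q\<^sup>T *\<^sub>v (Q *\<^sub>v x) = x"
      using that QtQ by (simp add: assoc_mult_mat_vec[of _ n n _ n, symmetric])
    finally show ?thesis .
  qed
  have "orthogonal_to_walks n A (Q *\<^sub>v ?b)"
    unfolding orthogonal_to_walks_def walks[symmetric]
    using iso orthogonal_to_walksD(2)[OF orthogonal_to_walks_cofactor_vec[OF B] B] by auto
  then obtain s where s: "Q *\<^sub>v ?b = s \<cdot>\<^sub>v ?a"
    using orthogonal_to_walks_imp_multiple[OF n A nonzero_A] by blast
  have pos: "?a \<bullet> ?a > 0" using nonzero_A by (intro scalar_prod_self_pos[of _ n]) auto
  have "s * s * (?a \<bullet> ?a) = ?a \<bullet> ?a"
    using iso[of ?b ?b] cofactor_vec_norm_eq unfolding s by (simp add: mult_ac)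
  hence "s * s = 1" using pos by simp
  hence s1: "s \<in> {1, -1}" by (simp add: square_eq_1_iff)
  let ?M = "bordered_walk_mat n A ((s * c) \<cdot>\<^sub>v ?a)" and ?N = "bordered_walk_mat n B (c \<cdot>\<^sub>v ?b)"
  have M: "?M \<in> carrier_mat n n" and N: "?N \<in> carrier_mat n n" using n by auto
  have "Q *\<^sub>v (c \<cdot>\<^sub>v ?b) = (s * c) \<cdot>\<^sub>v ?a" using s by (simp add: mult_mat_vec[of _ n n] smult_smult_assoc mult.commute)
  hence "col (Q * ?N) j = col ?M j" if "j < n" for j
    using that n walks by (simp add: col_mult2[OF Qc N] col_bordered_walk_mat)
  hence QN: "Q * ?N = ?M" using carrier_matD[OF M] carrier_matD[OF N] carrier_matD[OF Qc]
    by (intro mat_col_eqI) auto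
  have "Q = Q * (?N * P)" unfolding P(1) by simp
  also have "\<dots> = ?M * P" unfolding QN[symmetric] using P(2) N by (simp add: assoc_mult_mat[of _ n n _ n _ n])
  finally show ?thesis using s1 by blast
qed

end

section \<open>Generalized cospectral graphs\<close>

lemma adjacency_mat_carrier [simp]: "adjacency_mat n G \<in> carrier_mat n n"
  unfolding adjacency_mat_def by simp

lemma transpose_adjacency_mat:
  assumes "G \<in> graphs_on n"
  shows "(adjacency_mat n G)\<^sup>T = adjacency_mat n G"
proof -
  interpret pair_graph G using assms by (simp add: graphs_on_def)
  show ?thesis by (rule eq_matI) (auto simp: adjacency_mat_def dest: arcs_symmetric)
qed

lemma adjacency_mat_diagonal:
  assumes "G \<in> graphs_on n" "i < n"
  shows "adjacency_mat n G $$ (i, i) = 0"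
proof -
  interpret pair_graph G using assms by (simp add: graphs_on_def)
  show ?thesis using assms pair_no_loops[of "(Suc i, Suc i)"] by (auto simp: adjacency_mat_def)
qed

lemma adjacency_mat_complement:
  assumes "G \<in> graphs_on n"
  shows "adjacency_mat n (complement G) = mat n n (\<lambda>_. 1) - 1\<^sub>m n - adjacency_mat n G"
proof -
  have "(Suc i, Suc i) \<notin> parcs G" if "i < n" for i
    using adjacency_mat_diagonal[OF assms that] that by (simp add: adjacency_mat_def split: if_splits)
  thus ?thesis using assms
    by (intro eq_matI) (auto simp: adjacency_mat_def complement_def graphs_on_def)
qed

lemma walk_mat_eq_bordered:
  assumes "n > 0"
  shows "walk_mat n G = bordered_walk_mat n (adjacency_mat n G) (walk_vec n (adjacency_mat n G) (n - 1))"
proof -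
  have "[0..<n] = [0..<n - 1] @ [n - 1]" using assms by (cases n) auto
  thus ?thesis unfolding walk_mat_def bordered_walk_mat_def walk_vec_def by simp
qed

lemma modified_walk_mat_eq_bordered:
  assumes "n > 0"
  shows "modified_walk_mat n \<delta> G = bordered_walk_mat n (adjacency_mat n G)
    (((-1) ^ \<delta> * 2 powi (1 - int (n div 2))) \<cdot>\<^sub>v cofactor_vec n (adjacency_mat n G))"
  unfolding modified_walk_mat_def walk_cofactor_vec_def cofactor_vec_def walk_mat_eq_bordered[OF assms]
    bordered_walk_mat_def walk_vec_def ..

lemma equal_walk_counts_if_generalized_cospectral:
  assumes G: "G \<in> almost_controllable_graphs n" and H: "H \<in> graphs_on n"
    and cosp: "generalized_cospectral n G H"
  shows "equal_walk_counts n (adjacency_mat n G) (adjacency_mat n H)"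
proof -
  let ?A = "adjacency_mat n G" and ?B = "adjacency_mat n H"
  have G': "G \<in> graphs_on n" and rank: "vec_space.rank n (walk_mat n G) + 1 = n"
    using G by (auto simp: almost_controllable_graphs_def)
  have n: "n > 0" using rank by simp
  have cp: "char_poly ?A = char_poly ?B"
    by (rule char_poly_eq_if_mat_spectrum_eq[of _ n]) (use cosp in \<open>auto simp: generalized_cospectral_def\<close>)
  have "char_poly (adjacency_mat n (complement G)) = char_poly (adjacency_mat n (complement H))"
    by (rule char_poly_eq_if_mat_spectrum_eq[of _ n]) (use cosp in \<open>auto simp: generalized_cospectral_def\<close>)
  hence "char_poly (?A - mat n n (\<lambda>_. 1)) = char_poly (?B - mat n n (\<lambda>_. 1))"
    unfolding adjacency_mat_complement[OF G'] adjacency_mat_complement[OF H]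
    by (rule char_poly_minus_ones_from_complement[rotated 2]) auto
  note counts = walk_counts_determined[OF adjacency_mat_carrier adjacency_mat_carrier n cp this]
  let ?W = "bordered_walk_mat n ?A (walk_vec n ?A (n - 1))"
  have rank': "vec_space.rank n ?W + 1 = n" using rank n by (simp add: walk_mat_eq_bordered)
  have "det ?W = 0" using rank' vec_space.det_rank_iff[of ?W n] n by auto
  hence last: "cofactor_vec n ?A \<bullet> walk_vec n ?A (n - 1) = 0" using n by (simp add: det_bordered_walk_mat)
  show ?thesis
    by unfold_locales (use G' H n counts last cofactor_vec_nonzero[OF n adjacency_mat_carrier rank'] in
      \<open>auto simp: transpose_adjacency_mat adjacency_mat_diagonal\<close>)
qed

section \<open>Rationality\<close>

lemma det_in_Rats:
  fixes A :: "real mat"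
  assumes A: "A \<in> carrier_mat n n" and rat: "\<And>i j. i < n \<Longrightarrow> j < n \<Longrightarrow> A $$ (i, j) \<in> \<rat>"
  shows "det A \<in> \<rat>"
proof -
  have "signof p * (\<Prod>i = 0..<n. A $$ (i, p i)) \<in> \<rat>" if p: "p permutes {0..<n}" for p
  proof (rule Rats_mult)
    show "(signof p :: real) \<in> \<rat>" by (cases p rule: sign_cases) auto
    show "(\<Prod>i = 0..<n. A $$ (i, p i)) \<in> \<rat>"
      by (rule Rats_prod) (use p rat permutes_in_image[OF p] in auto)
  qed
  thus ?thesis unfolding det_def'[OF A] by (intro Rats_sum) auto
qed

lemma cofactor_in_Rats:
  fixes A :: "real mat"
  assumes A: "A \<in> carrier_mat n n" and rat: "\<And>i j. i < n \<Longrightarrow> j < n \<Longrightarrow> A $$ (i, j) \<in> \<rat>"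
  shows "cofactor A i j \<in> \<rat>"
proof -
  have "det (mat_delete A i j) \<in> \<rat>"
    by (rule det_in_Rats[OF mat_delete_carrier[OF A]]) (use A in \<open>auto simp: mat_delete_def intro!: rat\<close>)
  thus ?thesis unfolding cofactor_def by (simp add: Rats_mult Rats_power)
qed

lemma right_inverse_in_Rats:
  fixes A :: "real mat"
  assumes A: "A \<in> carrier_mat n n" and rat: "\<And>i j. i < n \<Longrightarrow> j < n \<Longrightarrow> A $$ (i, j) \<in> \<rat>"
    and B: "B \<in> carrier_mat n n" and inv: "A * B = 1\<^sub>m n" and ij: "i < n" "j < n"
  shows "B $$ (i, j) \<in> \<rat>"
proof -
  note adj = adj_mat[OF A]
  have "det A * det B = 1" using det_mult[OF A B] inv by simp
  hence nz: "det A \<noteq> 0" by auto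
  have "adj_mat A = (adj_mat A * A) * B"
    using adj(1) A B inv by (simp add: assoc_mult_mat[of _ n n _ n _ n] right_mult_one_mat[of _ n n])
  also have "\<dots> = det A \<cdot>\<^sub>m B" unfolding adj(3) using B
    by (simp add: mult_smult_assoc_mat[of _ n n _ n] left_mult_one_mat[of _ n n])
  finally have "adj_mat A $$ (i, j) = det A * B $$ (i, j)" using B ij by simp
  hence "B $$ (i, j) = cofactor A j i / det A" using nz ij A by (simp add: adj_mat_def field_simps)
  thus ?thesis using cofactor_in_Rats[OF A rat] det_in_Rats[OF A rat] by simp
qed

lemma walk_vec_in_Rats:
  assumes "r < n"
  shows "walk_vec n (adjacency_mat n G) k $ r \<in> \<rat>"
  using assms
proof (induction k arbitrary: r)
  case 0
  thus ?case by (simp add: walk_vec_0[of _ n] ones_vec_def)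
next
  case (Suc k)
  have "walk_vec n (adjacency_mat n G) (Suc k) $ r
     = (\<Sum>s<n. adjacency_mat n G $$ (r, s) * walk_vec n (adjacency_mat n G) k $ s)"
    unfolding walk_vec_Suc[OF adjacency_mat_carrier]
    by (rule mult_mat_vec_index_sum[of _ n n]) (use Suc in auto)
  also have "\<dots> \<in> \<rat>"
    using Suc by (intro Rats_sum Rats_mult) (auto simp: adjacency_mat_def)
  finally show ?case .
qed

lemma modified_walk_mat_in_Rats:
  assumes n: "n > 0" and ij: "i < n" "j < n"
  shows "modified_walk_mat n \<delta> G $$ (i, j) \<in> \<rat>"
proof -
  have "cofactor_vec n (adjacency_mat n G) $ i \<in> \<rat>"
    using n ij unfolding cofactor_vec_def
    by (auto simp: index_bordered_walk_mat walk_vec_in_Rats intro!: cofactor_in_Rats[of _ n])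
  moreover have "(2 :: real) powi k \<in> \<rat>" for k
    by (cases k rule: int_cases2) (auto simp: power_int_minus Rats_inverse Rats_power)
  ultimately show ?thesis using n ij
    by (simp add: modified_walk_mat_eq_bordered index_bordered_walk_mat walk_vec_in_Rats Rats_mult Rats_power)
qed

lemma elements_mat_mult_subset_Rats:
  fixes A B :: "real mat"
  assumes "A \<in> carrier_mat n n" "B \<in> carrier_mat n n"
    and "\<And>i j. i < n \<Longrightarrow> j < n \<Longrightarrow> A $$ (i, j) \<in> \<rat>" "\<And>i j. i < n \<Longrightarrow> j < n \<Longrightarrow> B $$ (i, j) \<in> \<rat>"
  shows "elements_mat (A * B) \<subseteq> \<rat>"
  using assms by (auto simp: scalar_prod_def dest!: elements_matD intro!: Rats_sum Rats_mult)

section \<open>The two solutions\<close>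

theorem theorem3:
  fixes n :: nat and G H :: "nat pair_pre_digraph"
  assumes "G \<in> almost_controllable_graphs n"
    and "H \<in> graphs_on n"
    and "generalized_cospectral n G H"
  shows "invertible_mat (modified_walk_mat n 0 H) \<and>
    (let W\<^sub>0H_inv = the (mat_inverse (modified_walk_mat n 0 H));
         Q\<^sub>0 = modified_walk_mat n 0 G * W\<^sub>0H_inv;
         Q\<^sub>1 = modified_walk_mat n 1 G * W\<^sub>0H_inv
     in {Q \<in> RO n. transpose_mat Q * adjacency_mat n G * Q = adjacency_mat n H} = {Q\<^sub>0, Q\<^sub>1} \<and>
        Q\<^sub>0 \<noteq> Q\<^sub>1 \<and>
        elements_mat Q\<^sub>0 \<subseteq> \<rat> \<and> elements_mat Q\<^sub>1 \<subseteq> \<rat>)"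
proof -
  let ?A = "adjacency_mat n G" and ?B = "adjacency_mat n H"
  interpret equal_walk_counts n ?A ?B
    by (rule equal_walk_counts_if_generalized_cospectral[OF assms])
  define c :: real where "c = 2 powi (1 - int (n div 2))"
  have c: "c \<noteq> 0" unfolding c_def by simp
  define M where "M s = bordered_walk_mat n ?A ((s * c) \<cdot>\<^sub>v cofactor_vec n ?A)" for s
  define N where "N = bordered_walk_mat n ?B (c \<cdot>\<^sub>v cofactor_vec n ?B)"
  have M: "M s \<in> carrier_mat n n" and N: "N \<in> carrier_mat n n" for s unfolding M_def N_def using n by auto
  have WG: "modified_walk_mat n 0 G = M 1" "modified_walk_mat n 1 G = M (-1)"
    and WH: "modified_walk_mat n 0 H = N"
    unfolding M_def N_def c_def using n by (simp_all add: modified_walk_mat_eq_bordered)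
  have "det N = c * (cofactor_vec n ?B \<bullet> cofactor_vec n ?B)"
    unfolding N_def using n by (simp add: det_bordered_walk_mat)
  hence "det N \<noteq> 0" using c scalar_prod_self_pos[OF cofactor_vec_carrier nonzero_B] by simp
  hence "mat_inverse N \<noteq> None" using mat_inverse(1)[OF N, where b = n] det_non_zero_imp_unit[OF N, where b = n] by blast
  then obtain P where P: "mat_inverse N = Some P" by auto
  have NP: "N * P = 1\<^sub>m n" and PN: "P * N = 1\<^sub>m n" and Pc: "P \<in> carrier_mat n n"
    using mat_inverse(2)[OF N P] by auto
  have inv: "invertible_mat N" unfolding invertible_mat_def inverts_mat_def
    using N Pc NP PN by (auto intro!: exI[of _ P])
  have sols: "{Q \<in> RO n. Q\<^sup>T * ?A * Q = ?B} = {M 1 * P, M (-1) * P}"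
  proof (intro subset_antisym subsetI)
    fix Q assume "Q \<in> {Q \<in> RO n. Q\<^sup>T * ?A * Q = ?B}"
    thus "Q \<in> {M 1 * P, M (-1) * P}"
      using solution_form[OF NP[unfolded N_def] Pc, of Q] unfolding M_def by auto
  next
    fix Q assume "Q \<in> {M 1 * P, M (-1) * P}"
    then obtain s :: real where s: "s * s = 1" "Q = M s * P"
      using that[of 1] that[of "- 1"] by auto
    show "Q \<in> {Q \<in> RO n. Q\<^sup>T * ?A * Q = ?B}"
      using solution_in_RO[OF c NP[unfolded N_def] Pc s(1)] solution_conjugates[OF c NP[unfolded N_def] Pc s(1)]
      unfolding s(2) M_def by simp
  qed
  have neq: "M 1 * P \<noteq> M (-1) * P"
  proof
    assume eq: "M 1 * P = M (-1) * P"
    have "M s = M s * P * N" for s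
      using M N Pc PN by (simp add: assoc_mult_mat[of _ n n _ n _ n] right_mult_one_mat[of _ n n])
    hence "M 1 = M (-1)" using eq by metis
    have last: "M s $$ (i, n - 1) = s * c * cofactor_vec n ?A $ i" if "i < n" for s i
      using that n by (simp add: M_def index_bordered_walk_mat)
    have "cofactor_vec n ?A $ i = 0" if "i < n" for i
      using last[OF that, of 1] last[OF that, of "- 1"] \<open>M 1 = M (-1)\<close> c by simp
    hence "cofactor_vec n ?A = 0\<^sub>v n" by (intro eq_vecI) auto
    thus False using nonzero_A by simp
  qed
  have "elements_mat (modified_walk_mat n \<delta> G * P) \<subseteq> \<rat>" for \<delta>
  proof (rule elements_mat_mult_subset_Rats)
    show "modified_walk_mat n \<delta> G \<in> carrier_mat n n" using n by (simp add: modified_walk_mat_eq_bordered)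
    show "P $$ (i, j) \<in> \<rat>" if "i < n" "j < n" for i j
      by (rule right_inverse_in_Rats[OF N _ Pc NP that]) (use modified_walk_mat_in_Rats[OF n] WH in metis)
  qed (use Pc modified_walk_mat_in_Rats[OF n] in auto)
  hence "elements_mat (M 1 * P) \<subseteq> \<rat>" "elements_mat (M (- 1) * P) \<subseteq> \<rat>" unfolding WG[symmetric] by simp_all
  thus ?thesis using inv sols neq unfolding WH WG Let_def P option.sel by blast
qed

end
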